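(* Let $q$ be a prime power and $k\ge 2$ an integer. Let $v\equiv 1\pmod{k(k-1)}$ be a prime. Assume that $\frac{[v-1]_q}{[k]_q[k-1]_q}=uv$ for some integer $u$ and that $q\not\equiv 1\pmod v$. If $\mathcal{I}$ is a set of $u$ projective subspaces of dimension $k-1$ of $\mathrm{PG}(\mathbb{F}_q^v)$ such that $\Delta\mathcal{I}$ is evenly distributed over the $\frac{[v]_q-1}{v}$ orbits of $\mathrm{Frob}([\mathbb{Z}_v]_q)$ on $[\mathbb{Z}_v]_q^*$, then $\mathcal{I}$ is a collection of initial base blocks of a $(v,k,1)_q$ difference family, i.e., the family $(B^\alpha)_{B\in\mathcal{I},\,\alpha\in\mathrm{Frob}([\mathbb{Z}_v]_q)}$ is a $(v,k,1)_q$ difference family.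
   Context: $[n]_q=\frac{q^n-1}{q-1}$. The Singer group $[\mathbb{Z}_v]_q=\mathbb{F}_{q^v}^*/\mathbb{F}_q^*$ is cyclic of order $[v]_q$; its elements are identified with the points of $\mathrm{PG}(\mathbb{F}_q^v)$; $[\mathbb{Z}_v]_q^*$ is the set of non-identity elements. $\mathrm{Frob}([\mathbb{Z}_v]_q)=\{\phi^i:0\le i\le v-1\}$ with $\phi(x)=x^q$. For a set $B$ of points, $\Delta B$ is the multiset of $xy^{-1}$ over ordered pairs $(x,y)$ of distinct elements of $B$; $\Delta\mathcal{I}$ is the multiset union; $B^\alpha=\{\alpha(b):b\in B\}$. Evenly distributed: each orbit contains the same number of elements of $\Delta\mathcal{I}$, with multiplicity. A $(v,k,1)_q$ difference family is a collection of $(k-1)$-dimensional projective subspaces of $\mathrm{PG}(\mathbb{F}_q^v)$ whose list of differences contains every element of $[\mathbb{Z}_v]_q^*$ exactly once. *)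

theory Defs
  imports
    "HOL-Algebra.Embedded_Algebras"
    "HOL-Algebra.Multiplicative_Group"
    "HOL-Algebra.Group_Action"
    "HOL-Library.Multiset"
    "HOL-Number_Theory.Cong"
    "HOL-Number_Theory.Prime_Powers"
begin

definition q_bracket :: "nat \<Rightarrow> nat \<Rightarrow> real" where
  "q_bracket q n = (real q ^ n - 1) / (real q - 1)"

text \<open>Throughout, \<open>F\<close> is the field of order \<open>q^v\<close> and \<open>K\<close> its subfield of order \<open>q\<close>; \<open>F\<close>, as
  a vector space over \<open>K\<close>, plays the role of the \<open>v\<close>-dimensional space. The points of its
  projective geometry are identified with the cosets of the multiplicative group of \<open>K\<close>, i.e.
  with the elements of the Singer group.\<close>

definition singer_group :: "('a, 'b) ring_scheme \<Rightarrow> 'a set \<Rightarrow> 'a set monoid" where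
  "singer_group F K = mult_of F Mod (K - {\<zero>\<^bsub>F\<^esub>})"

definition proj_point :: "('a, 'b) ring_scheme \<Rightarrow> 'a set \<Rightarrow> 'a \<Rightarrow> 'a set" where
  "proj_point F K x = (K - {\<zero>\<^bsub>F\<^esub>}) #>\<^bsub>mult_of F\<^esub> x"

definition proj_subspace ::
  "('a, 'b) ring_scheme \<Rightarrow> 'a set \<Rightarrow> nat \<Rightarrow> 'a set set \<Rightarrow> bool" where
  "proj_subspace F K d B \<longleftrightarrow>
     (\<exists>W. ring.dimension F (d + 1) K W \<and> B = proj_point F K ` (W - {\<zero>\<^bsub>F\<^esub>}))"

text \<open>The powers of \<open>x \<mapsto> x^q\<close>, made extensional so that equal maps on the group are equal
  as functions (cf. \<^const>\<open>Bij\<close>).\<close>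

definition frob :: "('g, 'c) monoid_scheme \<Rightarrow> nat \<Rightarrow> nat \<Rightarrow> ('g \<Rightarrow> 'g) set" where
  "frob G q v = {restrict ((\<lambda>x. x [^]\<^bsub>G\<^esub> q) ^^ i) (carrier G) | i. i \<le> v - 1}"

definition frob_orbits :: "('g, 'c) monoid_scheme \<Rightarrow> nat \<Rightarrow> nat \<Rightarrow> 'g set set" where
  "frob_orbits G q v =
     orbits (AutoGroup G\<lparr>carrier := frob G q v\<rparr>) (carrier G - {\<one>\<^bsub>G\<^esub>}) (\<lambda>\<alpha>. \<alpha>)"

definition differences :: "('g, 'c) monoid_scheme \<Rightarrow> 'g set \<Rightarrow> 'g multiset" where
  "differences G B =
     {# x \<otimes>\<^bsub>G\<^esub> inv\<^bsub>G\<^esub> y. (x, y) \<in># mset_set {(x, y). x \<in> B \<and> y \<in> B \<and> x \<noteq> y} #}"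

definition family_differences ::
  "('g, 'c) monoid_scheme \<Rightarrow> 'i set \<Rightarrow> ('i \<Rightarrow> 'g set) \<Rightarrow> 'g multiset" where
  "family_differences G J D = (\<Sum>j\<in>J. differences G (D j))"

definition evenly_distributed :: "'g multiset \<Rightarrow> 'g set set \<Rightarrow> bool" where
  "evenly_distributed M \<Omega> \<longleftrightarrow>
     (\<exists>c. \<forall>X\<in>\<Omega>. size {# x \<in># M. x \<in> X #} = c)"

text \<open>A \<open>(v,k,1)\<close> difference family over the field \<open>K\<close>, as a family \<open>D\<close> indexed by the
  finite set \<open>J\<close>, so that repeated blocks count with multiplicity.\<close>

definition q_difference_family ::
  "('a, 'b) ring_scheme \<Rightarrow> 'a set \<Rightarrow> nat \<Rightarrow> 'i set \<Rightarrow> ('i \<Rightarrow> 'a set set) \<Rightarrow> bool" where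
  "q_difference_family F K k J D \<longleftrightarrow>
     finite J \<and>
     (\<forall>j\<in>J. proj_subspace F K (k - 1) (D j)) \<and>
     (\<forall>g \<in> carrier (singer_group F K) - {\<one>\<^bsub>singer_group F K\<^esub>}.
        count (family_differences (singer_group F K) J D) g = 1)"

end

theory Submission
  imports Defs "HOL-Number_Theory.Pocklington"
begin

text \<open>The Singer group \<open>G\<close> has order \<open>N = 1 + q + \<dots> + q^(v-1)\<close>. If \<open>x \<noteq> 1\<close> had a Frobenius orbit
  shorter than \<open>v\<close>, then, \<open>v\<close> being prime, the order \<open>d\<close> of \<open>x\<close> would divide \<open>q - 1\<close>; hence
  \<open>N \<equiv> v\<close> modulo \<open>d\<close>, so \<open>d = v\<close> divides \<open>q - 1\<close>, which is excluded. So all orbits on the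
  non-identity elements have length \<open>v\<close>. The number of differences of the \<open>u\<close> subspaces is
  \<open>u [k] ([k] - 1) = u q [k] [k-1] = (N - 1) / v\<close>, which is the number of orbits, so an even
  distribution puts exactly one difference on every orbit, and applying the Frobenius group
  covers every non-identity element exactly once. Finally \<open>x \<mapsto> x^q\<close> is an injective \<open>K\<close>-linear
  map of \<open>F\<close>, so it maps subspaces to subspaces of the same dimension.\<close>

section \<open>The Frobenius map\<close>

text \<open>Induction on \<open>n\<close> by Pascal's rule; the expansion serves to make p-th powers
  additive in characteristic p.\<close>

lemma (in cring) binomial_finsum:
  assumes x: "x \<in> carrier R" and y: "y \<in> carrier R"
  shows "(x \<oplus> y) [^] (n::nat) = (\<Oplus>k\<in>{..n}. [(n choose k)] \<cdot>\<^bsub>R\<^esub> (x [^] k \<otimes> y [^] (n - k)))"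
proof (induction n)
  case 0
  show ?case by simp
next
  case (Suc n)
  define T where "T n k = [(n choose k)] \<cdot>\<^bsub>R\<^esub> (x [^] k \<otimes> y [^] (n - k))" for n k :: nat
  have T_closed [simp]: "T n k \<in> carrier R" for n k
    using x y by (simp add: T_def)
  have T_Suc: "T (Suc n) (Suc k) = x \<otimes> T n k \<oplus> y \<otimes> T n (Suc k)" if "k \<le> n" for k
  proof -
    have "x \<otimes> T n k = [(n choose k)] \<cdot>\<^bsub>R\<^esub> (x [^] Suc k \<otimes> y [^] (n - k))"
      using x y by (simp add: T_def add_pow_rdistr m_assoc m_comm m_lcomm)
    \<comment> \<open>For \<open>k = n\<close> the truncated exponent \<open>n - Suc k\<close>
      cannot absorb the factor \<open>y\<close>, but the binomial coefficient is then 0.\<close>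
    moreover have "y \<otimes> T n (Suc k) = [(n choose Suc k)] \<cdot>\<^bsub>R\<^esub> (x [^] Suc k \<otimes> y [^] (n - k))"
    proof (cases "k = n")
      case False
      with that have "n - k = Suc (n - Suc k)" by simp
      then show ?thesis
        using x y by (simp add: T_def add_pow_rdistr m_assoc m_comm m_lcomm)
    qed (use x y in \<open>simp add: T_def binomial_eq_0\<close>)
    ultimately show ?thesis
      using x y by (simp add: T_def add.nat_pow_mult)
  qed
  have T_0: "T (Suc n) 0 = y \<otimes> T n 0"
    using x y by (simp add: T_def m_comm)
  have T_top: "T n (Suc n) = \<zero>"
    by (simp add: T_def binomial_eq_0)
  have "finsum R (T (Suc n)) {..Suc n} = finsum R (\<lambda>k. T (Suc n) (Suc k)) {..n} \<oplus> T (Suc n) 0"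
    by (rule finsum_Suc2) simp
  also have "finsum R (\<lambda>k. T (Suc n) (Suc k)) {..n}
      = finsum R (\<lambda>k. x \<otimes> T n k \<oplus> y \<otimes> T n (Suc k)) {..n}"
    using x y by (intro finsum_cong') (auto simp: T_Suc)
  also have "\<dots> = finsum R (\<lambda>k. x \<otimes> T n k) {..n} \<oplus> finsum R (\<lambda>k. y \<otimes> T n (Suc k)) {..n}"
    using x y by (intro finsum_addf) auto
  also have "\<dots> = x \<otimes> finsum R (T n) {..n} \<oplus> y \<otimes> finsum R (\<lambda>k. T n (Suc k)) {..n}"
    using x y by (simp add: finsum_rdistr)
  also have "\<dots> \<oplus> T (Suc n) 0
      = x \<otimes> finsum R (T n) {..n} \<oplus> y \<otimes> (finsum R (\<lambda>k. T n (Suc k)) {..n} \<oplus> T n 0)"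
    using x y by (simp add: T_0 r_distr a_assoc)
  also have "finsum R (\<lambda>k. T n (Suc k)) {..n} \<oplus> T n 0 = finsum R (T n) {..Suc n}"
    by (rule finsum_Suc2[symmetric]) simp
  also have "\<dots> = finsum R (T n) {..n}"
    by (simp add: finsum_Suc T_top)
  also have "x \<otimes> finsum R (T n) {..n} \<oplus> y \<otimes> finsum R (T n) {..n} = finsum R (T n) {..n} \<otimes> (x \<oplus> y)"
    using x y by (simp add: r_distr m_comm[of x] m_comm[of y])
  also have "finsum R (T n) {..n} = (x \<oplus> y) [^] n"
    by (simp add: Suc T_def[abs_def])
  finally show ?case
    by (simp add: T_def)
qed

text \<open>The prime p divides every inner binomial coefficient, and p-fold sums vanish because p
  times 1 does; only the two extreme terms survive.\<close>

lemma (in cring) add_pow_prime_char: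
  assumes p: "prime p" and char: "[p] \<cdot>\<^bsub>R\<^esub> \<one> = \<zero>" and x: "x \<in> carrier R" and y: "y \<in> carrier R"
  shows "(x \<oplus> y) [^] (p::nat) = x [^] p \<oplus> y [^] p"
proof -
  let ?T = "\<lambda>k. [(p choose k)] \<cdot>\<^bsub>R\<^esub> (x [^] k \<otimes> y [^] (p - k))"
  have T_closed: "?T k \<in> carrier R" for k
    using x y by simp
  have mult_0: "[(p * m)] \<cdot>\<^bsub>R\<^esub> a = \<zero>" if "a \<in> carrier R" for a and m :: nat
  proof -
    have "[p] \<cdot>\<^bsub>R\<^esub> a = [p] \<cdot>\<^bsub>R\<^esub> \<one> \<otimes> a"
      using that by (simp add: add_pow_ldistr)
    then show ?thesis
      using that char by (simp add: add.nat_pow_pow[symmetric])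
  qed
  have T_0: "?T k = \<zero>" if "k \<in> {1..<p}" for k
  proof -
    have "p dvd p choose k"
      using that p by (intro dvd_choose_prime) auto
    then show ?thesis
      using mult_0[of "x [^] k \<otimes> y [^] (p - k)"] x y by (auto elim!: dvdE)
  qed
  have p0: "p > 0" using p by (rule prime_gt_0_nat)
  have "(x \<oplus> y) [^] p = finsum R ?T {..p}"
    by (rule binomial_finsum[OF x y])
  also have "\<dots> = finsum R ?T {0, p}"
    using T_0 T_closed by (intro add.finprod_mono_neutral_cong_right) auto
  also have "\<dots> = ?T 0 \<oplus> ?T p"
    using x y p0 by (subst finsum_insert) auto
  also have "\<dots> = x [^] p \<oplus> y [^] p"
    using x y by (simp add: a_comm)
  finally show ?thesis .
qed

lemma (in cring) add_pow_prime_power_char: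
  assumes "prime p" and "[p] \<cdot>\<^bsub>R\<^esub> \<one> = \<zero>" and "x \<in> carrier R" and "y \<in> carrier R"
  shows "(x \<oplus> y) [^] (p ^ m :: nat) = x [^] (p ^ m) \<oplus> y [^] (p ^ m)"
proof (induction m)
  case (Suc m)
  have "z [^] (p ^ Suc m) = (z [^] (p ^ m)) [^] p" if "z \<in> carrier R" for z
    using that by (simp add: nat_pow_pow mult.commute)
  then show ?case
    using Suc assms add_pow_prime_char by simp
qed (use assms in simp)

text \<open>By Lagrange in the additive group, \<open>p ^ n\<close> copies of 1 sum to 0. This sum
  is the n-th power of p times 1, and a domain has no zero divisors.\<close>

lemma (in domain) char_of_prime_power_order:
  assumes "order R = p ^ n" and "finite (carrier R)"
  shows "[(p::nat)] \<cdot>\<^bsub>R\<^esub> \<one> = \<zero>"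
proof (rule ccontr)
  assume *: "[p] \<cdot>\<^bsub>R\<^esub> \<one> \<noteq> \<zero>"
  have "[(p ^ m)] \<cdot>\<^bsub>R\<^esub> \<one> \<noteq> \<zero>" for m
  proof (induction m)
    case (Suc m)
    have "[(p ^ Suc m)] \<cdot>\<^bsub>R\<^esub> \<one> = [p] \<cdot>\<^bsub>R\<^esub> \<one> \<otimes> [(p ^ m)] \<cdot>\<^bsub>R\<^esub> \<one>"
      by (simp add: add_pow_ldistr add.nat_pow_pow mult.commute)
    with Suc * show ?case
      using integral_iff by auto
  qed simp
  moreover have "[order R] \<cdot>\<^bsub>R\<^esub> \<one> = \<zero>"
    using add.pow_order_eq_1[of \<one>] by (simp add: order_def)
  ultimately show False
    using assms by simp
qed

section \<open>Linear images and cardinalities of subspaces over a subfield\<close>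

text \<open>A subspace is built by repeatedly adjoining a vector outside the space reached so far.
  Linearity carries each extension to the image, and injectivity keeps the new vector
  outside.\<close>

lemma (in ring) dimension_linear_image:
  assumes dim: "dimension n K W" and K: "subfield K R"
    and f: "f \<in> carrier R \<rightarrow> carrier R" and inj: "inj_on f (carrier R)"
    and add: "\<And>x y. \<lbrakk>x \<in> carrier R; y \<in> carrier R\<rbrakk> \<Longrightarrow> f (x \<oplus> y) = f x \<oplus> f y"
    and smult: "\<And>a x. \<lbrakk>a \<in> K; x \<in> carrier R\<rbrakk> \<Longrightarrow> f (a \<otimes> x) = a \<otimes> f x"
    and zero: "f \<zero> = \<zero>"
  shows "dimension n K (f ` W)"
  \<comment> \<open>The field is an argument of the inductive predicate and varies in the induction,
    so the facts about \<open>K\<close> are carried along.\<close>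
  using dim K smult
proof induction
  case (zero_dim K)
  then show ?case using zero by simp
next
  case (Suc_dim v E n K)
  have E: "E \<subseteq> carrier R"
    using Suc_dim.hyps(3) Suc_dim.prems(1) by (rule space_subgroup_props(1)[rotated])
  have im: "f (a \<otimes> v \<oplus> e) = a \<otimes> f v \<oplus> f e" if "a \<in> K" "e \<in> E" for a e
  proof -
    have "a \<in> carrier R" "e \<in> carrier R"
      using that E subfieldE(3)[OF Suc_dim.prems(1)] by auto
    then show ?thesis
      using that add[of "a \<otimes> v" e] Suc_dim.prems(2) Suc_dim.hyps(1) by simp
  qed
  have "f ` line_extension K v E = line_extension K (f v) (f ` E)"
  proof -
    have ext: "line_extension K w D = (\<lambda>(a, e). a \<otimes> w \<oplus> e) ` (K \<times> D)" for w D
      by (auto simp: line_extension_mem_iff image_iff; blast)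
    have "f ` line_extension K v E = (\<lambda>(a, e). a \<otimes> f v \<oplus> f e) ` (K \<times> E)"
      unfolding ext image_image using im by (intro image_cong) auto
    also have "\<dots> = line_extension K (f v) (f ` E)"
      unfolding ext by force
    finally show ?thesis .
  qed
  moreover have "f v \<notin> f ` E"
    using inj E Suc_dim.hyps by (auto simp: inj_on_def)
  ultimately show ?case
    using Suc_dim f by (auto intro!: dimension.Suc_dim)
qed

text \<open>Coordinates with respect to a basis identify \<open>W\<close> with the lists of length
  \<open>n\<close> over \<open>K\<close>.\<close>

lemma (in ring) card_dimension:
  assumes K: "subfield K R" and dim: "dimension n K W" and fin: "finite K"
  shows "card W = card K ^ n"
proof -
  obtain Us where Us: "set Us \<subseteq> carrier R" "independent K Us" "length Us = n" "Span K Us = W"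
    using exists_base[OF K dim] by blast
  let ?L = "{Ks. set Ks \<subseteq> K \<and> length Ks = n}"
  have "W = (\<lambda>Ks. combine Ks Us) ` ?L"
    using Span_eq_combine_set_length_version[OF K Us(1)] Us(3,4) by auto
  moreover have "inj_on (\<lambda>Ks. combine Ks Us) ?L"
  proof (rule inj_onI)
    fix Ks Ls
    assume *: "Ks \<in> ?L" "Ls \<in> ?L" "combine Ks Us = combine Ls Us"
    have "combine Ks Us \<in> Span K Us"
      using Span_eq_combine_set_length_version[OF K Us(1)] * Us(3) by auto
    from unique_decomposition[OF K Us(2) this] show "Ks = Ls"
      using * Us(3) by (metis (mono_tags, lifting) mem_Collect_eq)
  qed
  ultimately show ?thesis
    using fin by (simp add: card_image card_lists_length_eq)
qed

section \<open>Frobenius orbits and differences in a finite abelian group\<close>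

lemma (in monoid) funpow_pow:
  assumes "x \<in> carrier G"
  shows "((\<lambda>x. x [^] (q::nat)) ^^ i) x = x [^] (q ^ i)"
  using assms by (induction i) (simp_all add: nat_pow_pow mult.commute)

text \<open>Iterated q-th powers become single powers. At \<open>v = 0\<close> the truncated bound
  \<open>i \<le> v - 1\<close> would still admit \<open>i = 0\<close>.\<close>

lemma (in monoid) frob_eq:
  assumes "v > 0"
  shows "frob G q v = (\<lambda>i. restrict (\<lambda>x. x [^] (q ^ i)) (carrier G)) ` {..<v}"
proof -
  have "restrict ((\<lambda>x. x [^] q) ^^ i) (carrier G) = restrict (\<lambda>x. x [^] (q ^ i)) (carrier G)" for i
    by (rule restrict_ext) (rule funpow_pow)
  moreover have "i \<le> v - 1 \<longleftrightarrow> i < v" for i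
    using assms by auto
  ultimately show ?thesis
    unfolding frob_def by auto
qed

section \<open>Geometric sums and the length of Frobenius orbits\<close>

lemma sum_powers_cong:
  fixes q :: nat
  assumes "[q = 1] (mod d)"
  shows "[(\<Sum>i<v. q ^ i) = v] (mod d)"
proof -
  have "[(\<Sum>i<v. q ^ i) = (\<Sum>i<v. 1 ^ i)] (mod d)"
    using assms by (intro cong_sum cong_pow)
  then show ?thesis by simp
qed

text \<open>The identity (q - 1) N = q^v - 1 for the geometric sum N, arranged without subtraction
  of naturals.\<close>

lemma mult_sum_powers_Suc:
  fixes q :: nat
  shows "q * (\<Sum>i<v. q ^ i) + 1 = q ^ v + (\<Sum>i<v. q ^ i)"
proof -
  have "q * (\<Sum>i<v. q ^ i) + 1 = (\<Sum>i<Suc v. q ^ i)"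
    by (simp only: sum.lessThan_Suc_shift) (simp add: sum_distrib_left)
  then show ?thesis by simp
qed

lemma power_diff_1_eq_nat:
  fixes q :: nat
  shows "q ^ n - 1 = (q - 1) * (\<Sum>i<n. q ^ i)"
  using mult_sum_powers_Suc[of q n] by (simp add: diff_mult_distrib)

text \<open>A coincidence among the v powers forces q = 1 modulo the order \<open>d\<close> of
  \<open>x\<close>, since the multiplicative order of q modulo \<open>d\<close> divides both v and a
  smaller positive number. Then \<open>d\<close> divides v, so \<open>d = v\<close>, against the
  hypothesis on q.\<close>

lemma (in group) frobenius_orbit_inj:
  assumes x: "x \<in> carrier G" "x \<noteq> \<one>"
    and ord: "order G = (\<Sum>i<v. q ^ i)" and v: "prime v" and q: "\<not> [q = 1] (mod v)"
  shows "inj_on (\<lambda>i. x [^] (q ^ i)) {..<v}"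
proof -
  define d where "d = ord x"
  have d_N: "d dvd (\<Sum>i<v. q ^ i)"
    using ord_dvd_group_order[OF x(1)] by (simp add: d_def ord)
  obtain m where m: "v = Suc m"
    using prime_gt_0_nat[OF v] by (cases v) auto
  have N: "(\<Sum>i<v. q ^ i) = 1 + q * (\<Sum>i<m. q ^ i)"
    unfolding m by (simp only: sum.lessThan_Suc_shift) (simp add: sum_distrib_left)
  \<comment> \<open>\<open>d\<close> divides a number of the form 1 + q s; coprimality later allows
    cancelling \<open>q ^ i\<close> modulo \<open>d\<close>.\<close>
  have cop: "coprime d q"
  proof (rule coprime_divisors[OF d_N dvd_refl])
    show "coprime (\<Sum>i<v. q ^ i) q"
      unfolding N by (rule coprimeI) (metis dvd_add_left_iff dvd_mult2)
  qed
  have qv: "[q ^ v = 1] (mod d)"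
  proof -
    note mult_sum_powers_Suc[of q v]
    moreover have "[q * (\<Sum>i<v. q ^ i) + 1 = 0 + 1] (mod d)"
      using d_N by (intro cong_add) (auto simp: cong_0_iff)
    moreover have "[q ^ v + (\<Sum>i<v. q ^ i) = q ^ v + 0] (mod d)"
      using d_N by (intro cong_add) (auto simp: cong_0_iff)
    ultimately show ?thesis
      by (simp add: cong_def)
  qed
  have d1: "d \<noteq> 1"
    using x ord_eq_1 by (simp add: d_def)
  have neq: False if ij: "i < j" "j < v" and eq: "x [^] (q ^ i) = x [^] (q ^ j)" for i j
  proof -
    \<comment> \<open>Exponents of equal powers of \<open>x\<close> agree modulo its order; the
      integers make the difference of exponents meaningful.\<close>
    have "[q ^ i = q ^ j] (mod d)"
    proof -
      have "int d dvd int (q ^ j) - int (q ^ i)"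
        using eq int_pow_eq[OF x(1), of "int (q ^ i)" "int (q ^ j)"]
        by (simp only: int_pow_int d_def simp_thms)
      then have "[int (q ^ j) = int (q ^ i)] (mod int d)"
        by (simp only: cong_iff_dvd_diff)
      then show ?thesis
        by (simp only: cong_int_iff cong_sym_eq)
    qed
    then have "[q ^ i * 1 = q ^ i * q ^ (j - i)] (mod d)"
      using ij by (simp add: power_add[symmetric])
    then have "[q ^ (j - i) = 1] (mod d)"
      using cong_mult_lcancel_nat[of "q ^ i" d 1 "q ^ (j - i)"] cop
      by (metis cong_sym coprime_commute coprime_power_left_iff)
    then have "Pocklington.ord d q dvd j - i" "Pocklington.ord d q dvd v"
      using qv by (simp_all only: Pocklington.ord_divides)
    \<comment> \<open>Here 0 < j - i < v with v prime.\<close>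
    moreover have "coprime (j - i) v"
      using v ij by (intro prime_imp_coprime_nat[THEN coprime_commute[THEN iffD1]])
        (auto dest: dvd_imp_le)
    ultimately have "Pocklington.ord d q = 1"
      using coprime_common_divisor_nat by blast
    then have q1: "[q = 1] (mod d)"
      by (simp add: ord_eq_Suc_0_iff)
    \<comment> \<open>The geometric sum is 0 modulo \<open>d\<close> by Lagrange, and v modulo
      \<open>d\<close> because q = 1 there.\<close>
    then have "d dvd v"
      using sum_powers_cong[OF q1, of v] d_N by (meson cong_dvd_iff)
    then have "d = v"
      using v d1 by (auto simp: prime_nat_iff)
    then show False using q q1 by simp
  qed
  show ?thesis
    by (rule linorder_inj_onI') (use neq in auto)
qed

section \<open>Multisets of differences\<close>

lemma size_filter_mset_conv_sum_count:
  assumes "finite A"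
  shows "size {# x \<in># M. x \<in> A #} = (\<Sum>a\<in>A. count M a)"
proof -
  have "size {# x \<in># M. x \<in> A #} = (\<Sum>a\<in>A \<inter> set_mset M. count M a)"
    by (auto simp: size_multiset_overloaded_eq intro!: sum.cong)
  also have "\<dots> = (\<Sum>a\<in>A. count M a)"
    using assms by (intro sum.mono_neutral_left) (auto simp: not_in_iff)
  finally show ?thesis .
qed

lemma (in group) differences_subset:
  assumes "B \<subseteq> carrier G"
  shows "set_mset (differences G B) \<subseteq> carrier G - {\<one>}"
proof -
  have "x \<otimes> inv y \<noteq> \<one>" if "x \<in> carrier G" "y \<in> carrier G" "x \<noteq> y" for x y
    using that by (metis inv_closed inv_equality inv_inv)
  moreover have "set_mset (differences G B) \<subseteq> (\<lambda>(x, y). x \<otimes> inv y) ` {(x, y). x \<in> B \<and> y \<in> B \<and> x \<noteq> y}"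
    unfolding differences_def
    \<comment> \<open>On an infinite set \<open>mset_set\<close> is empty, so the inclusion is
      trivial in that case.\<close>
    by (cases "finite {(x, y). x \<in> B \<and> y \<in> B \<and> x \<noteq> y}") auto
  moreover have "(\<lambda>(x, y). x \<otimes> inv y) ` {(x, y). x \<in> B \<and> y \<in> B \<and> x \<noteq> y} \<subseteq> carrier G - {\<one>}"
    using assms calculation(1) by (auto simp: subset_iff)
  ultimately show ?thesis by (meson order_trans)
qed

lemma size_differences:
  assumes "finite B"
  shows "size (differences G B) = card B * (card B - 1)"
proof -
  have "{(x, y). x \<in> B \<and> y \<in> B \<and> x \<noteq> y} = Sigma B (\<lambda>x. B - {x})"
    by auto
  then show ?thesis
    using assms by (simp add: differences_def)
qed

text \<open>Injectivity matches the ordered pairs of distinct elements of \<open>B\<close> with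
  those of its image, and a homomorphism commutes with forming x y^(-1).\<close>

lemma (in group) differences_hom_image:
  assumes h: "h \<in> hom G G" and inj: "inj_on h (carrier G)" and B: "B \<subseteq> carrier G"
  shows "differences G (h ` B) = image_mset h (differences G B)"
proof -
  interpret h: group_hom G G h
    using h by unfold_locales
  let ?P = "\<lambda>B. {(x, y). x \<in> B \<and> y \<in> B \<and> x \<noteq> y}"
  have "inj_on h B"
    using inj B by (rule inj_on_subset)
  then have "?P (h ` B) = map_prod h h ` ?P B" "inj_on (map_prod h h) (?P B)"
    by (auto simp: inj_on_def image_iff)
  then have "mset_set (?P (h ` B)) = image_mset (map_prod h h) (mset_set (?P B))"
    by (simp add: image_mset_mset_set)
  then have "differences G (h ` B)
      = image_mset (\<lambda>(x, y). h x \<otimes> inv (h y)) (mset_set (?P B))"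
    by (simp add: differences_def multiset.map_comp comp_def case_prod_unfold)
  also have "\<dots> = image_mset h (differences G B)"
    unfolding differences_def multiset.map_comp
    using B by (intro image_mset_cong)
      (cases "finite (?P B)", auto simp: subset_iff)
  finally show ?thesis .
qed

section \<open>Counting differences along Frobenius orbits\<close>

lemma (in comm_group) pow_hom: "(\<lambda>x. x [^] (n::nat)) \<in> hom G G"
  by (auto simp: hom_def pow_mult_distrib m_comm)

context comm_group
begin

lemma pow_q_power_eq_self:
  assumes "x \<in> carrier G" and "order G = (\<Sum>i<v. q ^ i)"
  shows "x [^] (q ^ v :: nat) = x"
proof -
  \<comment> \<open>The inserted factor is 1; it turns the exponent into q^v + N = q N + 1 with N
    the group order.\<close>
  have "x [^] (q ^ v) = x [^] (q ^ v) \<otimes> x [^] order G"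
    using assms(1) by (simp add: pow_order_eq_1)
  also have "\<dots> = x [^] (order G * q + 1)"
    using assms(1) mult_sum_powers_Suc[of q v]
    by (simp only: nat_pow_mult assms(2)) (simp add: mult.commute)
  also have "\<dots> = x"
    using assms(1) by (simp add: nat_pow_pow[symmetric] pow_order_eq_1)
  finally show ?thesis .
qed

text \<open>The i-th and (v - i)-th Frobenius powers compose to the v-th, which is the identity. The
  reduction \<open>mod v\<close> sends \<open>i = 0\<close> to 0 instead of v, so the inverse index
  stays below v.\<close>

lemma frobenius_inverse:
  assumes "x \<in> carrier G" and "order G = (\<Sum>i<v. q ^ i)" and "i < v"
  shows "(x [^] (q ^ i)) [^] (q ^ ((v - i) mod v) :: nat) = x"
    and "(x [^] (q ^ ((v - i) mod v))) [^] (q ^ i :: nat) = x"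
proof -
  have "i + (v - i) mod v = 0 \<or> i + (v - i) mod v = v"
    using assms(3) by (cases "i = 0") auto
  then have "x [^] (q ^ (i + (v - i) mod v)) = x"
    using assms pow_q_power_eq_self by auto
  then show "(x [^] (q ^ i)) [^] (q ^ ((v - i) mod v)) = x"
    and "(x [^] (q ^ ((v - i) mod v))) [^] (q ^ i) = x"
    using assms(1) by (simp_all add: nat_pow_pow power_add mult.commute)
qed

lemma frobenius_bij_betw:
  assumes "order G = (\<Sum>i<v. q ^ i)" and "i < v"
  shows "bij_betw (\<lambda>x. x [^] (q ^ i :: nat)) (carrier G - {\<one>}) (carrier G - {\<one>})"
proof (rule bij_betw_byWitness[where f' = "\<lambda>x. x [^] (q ^ ((v - i) mod v))"])
  have "(x [^] (q ^ i)) \<noteq> \<one>" "x [^] (q ^ ((v - i) mod v)) \<noteq> \<one>" if "x \<in> carrier G" "x \<noteq> \<one>" for x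
    using frobenius_inverse[OF that(1) assms] that by auto
  then show "(\<lambda>x. x [^] (q ^ i)) ` (carrier G - {\<one>}) \<subseteq> carrier G - {\<one>}"
    "(\<lambda>x. x [^] (q ^ ((v - i) mod v))) ` (carrier G - {\<one>}) \<subseteq> carrier G - {\<one>}"
    by auto
qed (use assms in \<open>auto simp: frobenius_inverse\<close>)

lemma frobenius_inj_on:
  assumes "order G = (\<Sum>i<v. q ^ i)" and "i < v"
  shows "inj_on (\<lambda>x. x [^] (q ^ i :: nat)) (carrier G)"
  by (rule inj_on_inverseI[where g = "\<lambda>x. x [^] (q ^ ((v - i) mod v))"])
    (use assms in \<open>auto simp: frobenius_inverse\<close>)

lemma frob_orbits_eq:
  assumes "v > 0"
  shows "frob_orbits G q v = (\<lambda>x. (\<lambda>i. x [^] (q ^ i)) ` {..<v}) ` (carrier G - {\<one>})"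
proof -
  have "{\<alpha> x | \<alpha>. \<alpha> \<in> frob G q v} = (\<lambda>i. x [^] (q ^ i)) ` {..<v}" if "x \<in> carrier G" for x
    using that unfolding frob_eq[OF assms] Setcompr_eq_image image_image
    by (intro image_cong) auto
  moreover have "frob_orbits G q v = (\<lambda>x. {\<alpha> x | \<alpha>. \<alpha> \<in> frob G q v}) ` (carrier G - {\<one>})"
    unfolding frob_orbits_def orbits_def orbit_def by auto
  ultimately show ?thesis
    by (simp only:) (intro image_cong, auto)
qed

text \<open>The only preimage of \<open>g\<close> is its image under the inverse Frobenius power, so
  its multiplicity is read off there.\<close>

lemma count_frobenius_image:
  assumes ord: "order G = (\<Sum>i<v. q ^ i)" and "i < v" and g: "g \<in> carrier G"
    and M: "set_mset M \<subseteq> carrier G"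
  shows "count (image_mset (\<lambda>x. x [^] (q ^ i :: nat)) M) g = count M (g [^] (q ^ ((v - i) mod v)))"
proof -
  let ?y = "g [^] (q ^ ((v - i) mod v))"
  have "(\<lambda>x. x [^] (q ^ i)) -` {g} \<inter> set_mset M = {?y} \<inter> set_mset M"
    using frobenius_inverse[OF _ assms(1,2)] g M by auto
  then show ?thesis
    by (cases "?y \<in># M") (auto simp: count_image_mset not_in_iff)
qed

text \<open>The translate of \<open>B\<close> by \<alpha> contributes \<open>g\<close> as often as
  \<open>B\<close> contributes the preimage of \<open>g\<close> under \<alpha>. Summing over the
  cyclic Frobenius group, inverses run through the same group, so the total is a sum over the orbit
  of \<open>g\<close>.\<close>

lemma count_family_differences_frob:
  assumes ord: "order G = (\<Sum>i<v. q ^ i)" and v: "prime v" and q: "\<not> [q = 1] (mod v)"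
    and fin: "finite I" and I: "\<And>B. B \<in> I \<Longrightarrow> B \<subseteq> carrier G"
    and g: "g \<in> carrier G" "g \<noteq> \<one>"
  shows "count (family_differences G (I \<times> frob G q v) (\<lambda>(B, \<alpha>). \<alpha> ` B)) g
    = (\<Sum>i<v. count (family_differences G I (\<lambda>B. B)) (g [^] (q ^ i)))"
proof -
  have v0: "v > 0" using v by (rule prime_gt_0_nat)
  let ?M = "family_differences G I (\<lambda>B. B)"
  let ?f = "\<lambda>i x. x [^] (q ^ i)"
  let ?\<alpha> = "\<lambda>i. restrict (?f i) (carrier G)"
  have M: "set_mset ?M \<subseteq> carrier G"
    using differences_subset[OF I] fin by (auto simp: family_differences_def set_mset_sum)
  \<comment> \<open>Different exponents give different maps, as evaluation at \<open>g\<close>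
    shows; hence the sum over the set \<open>frob G q v\<close> is a sum over
    \<open>i < v\<close>.\<close>
  have inj: "inj_on ?\<alpha> {..<v}"
  proof (rule inj_onI)
    fix i j assume ij: "i \<in> {..<v}" "j \<in> {..<v}" and "?\<alpha> i = ?\<alpha> j"
    then have "?\<alpha> i g = ?\<alpha> j g" by simp
    then show "i = j"
      using frobenius_orbit_inj[OF g ord v q] ij g by (auto simp: inj_on_def)
  qed
  have diff: "differences G (?\<alpha> i ` B) = image_mset (?f i) (differences G B)"
    if "B \<in> I" "i < v" for B i
  proof -
    have "?\<alpha> i ` B = ?f i ` B"
      using I[OF that(1)] by (intro image_cong) auto
    then show ?thesis
      using differences_hom_image[OF pow_hom frobenius_inj_on[OF ord that(2)] I[OF that(1)]] by simp
  qed
  have "count (family_differences G (I \<times> frob G q v) (\<lambda>(B, \<alpha>). \<alpha> ` B)) g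
      = (\<Sum>B\<in>I. \<Sum>\<alpha>\<in>frob G q v. count (differences G (\<alpha> ` B)) g)"
    unfolding family_differences_def by (simp add: count_sum sum.cartesian_product case_prod_unfold)
  also have "\<dots> = (\<Sum>B\<in>I. \<Sum>i<v. count (image_mset (?f i) (differences G B)) g)"
    unfolding frob_eq[OF v0] sum.reindex[OF inj] comp_def
    by (intro sum.cong refl, subst diff) auto
  also have "\<dots> = (\<Sum>i<v. \<Sum>B\<in>I. count (image_mset (?f i) (differences G B)) g)"
    by (rule sum.swap)
  also have "\<dots> = (\<Sum>i<v. \<Sum>B\<in>I. count (differences G B) (?f ((v - i) mod v) g))"
    using differences_subset[OF I] g by (intro sum.cong refl count_frobenius_image[OF ord]) auto
  also have "\<dots> = (\<Sum>i<v. count ?M (?f ((v - i) mod v) g))"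
    by (simp add: family_differences_def count_sum)
  \<comment> \<open>Reindexing by the involution that sends i to (v - i) mod v.\<close>
  also have "\<dots> = (\<Sum>i<v. count ?M (?f i g))"
  proof -
    have "(v - (v - i) mod v) mod v = i" if "i < v" for i
      using that by (cases "i = 0") auto
    then show ?thesis
      using v0 by (intro sum.reindex_bij_witness[where i = "\<lambda>i. (v - i) mod v"
          and j = "\<lambda>i. (v - i) mod v"]) auto
  qed
  finally show ?thesis .
qed

text \<open>Double counting: with c elements of \<open>M\<close> on each orbit, summing the orbit
  counts over all non-identity points gives c times their number. Each Frobenius power permutes
  these points, so the same sum is \<open>v * size M\<close>, which equals their number; thus c =
  1.\<close>

lemma frobenius_orbit_meets_once:
  assumes ord: "order G = (\<Sum>i<v. q ^ i)" and v: "prime v" and q: "\<not> [q = 1] (mod v)"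
    and M: "set_mset M \<subseteq> carrier G - {\<one>}" and size: "v * size M = order G - 1"
    and even: "evenly_distributed M (frob_orbits G q v)"
    and g: "g \<in> carrier G" "g \<noteq> \<one>"
  shows "(\<Sum>i<v. count M (g [^] (q ^ i))) = 1"
proof -
  let ?S = "carrier G - {\<one>}"
  have v0: "v > 0" using v by (rule prime_gt_0_nat)
  \<comment> \<open>Positive order yields finiteness, since an infinite carrier has order 0.\<close>
  have "order G > 0"
    using v0 unfolding ord by (intro sum_pos2[where i = 0]) auto
  then have fin: "finite (carrier G)"
    by (simp add: order_gt_0_iff_finite)
  obtain c where c: "\<And>X. X \<in> frob_orbits G q v \<Longrightarrow> size {# x \<in># M. x \<in> X #} = c"
    using even by (auto simp: evenly_distributed_def)
  have orbit: "(\<Sum>i<v. count M (x [^] (q ^ i))) = c" if x: "x \<in> ?S" for x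
  proof -
    let ?X = "(\<lambda>i. x [^] (q ^ i)) ` {..<v}"
    have "?X \<in> frob_orbits G q v"
      using x by (auto simp: frob_orbits_eq[OF v0])
    \<comment> \<open>The orbit has full length v, so counting over it as a set agrees with summing
      over exponents.\<close>
    moreover have "size {# a \<in># M. a \<in> ?X #} = (\<Sum>i<v. count M (x [^] (q ^ i)))"
      using frobenius_orbit_inj[OF _ _ ord v q, of x] x
      by (simp add: size_filter_mset_conv_sum_count sum.reindex)
    ultimately show ?thesis using c by simp
  qed
  have size_M: "size M = (\<Sum>x\<in>?S. count M x)"
  proof -
    have "{# x \<in># M. x \<in> ?S #} = M"
      using M by (intro filter_mset_eq_conv[THEN iffD2]) auto
    then show ?thesis
      using size_filter_mset_conv_sum_count[of ?S M] fin by simp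
  qed
  have "card ?S * c = (\<Sum>x\<in>?S. \<Sum>i<v. count M (x [^] (q ^ i)))"
    using orbit by simp
  also have "\<dots> = (\<Sum>i<v. \<Sum>x\<in>?S. count M (x [^] (q ^ i)))"
    by (rule sum.swap)
  also have "\<dots> = (\<Sum>i<v. size M)"
    using sum.reindex_bij_betw[OF frobenius_bij_betw[OF ord], of _ "count M"] size_M
    by (intro sum.cong) auto
  also have "\<dots> = card ?S"
    using size fin by (simp add: order_def)
  finally have "card ?S * c = card ?S" .
  moreover have "card ?S > 0"
    unfolding card_gt_0_iff using g fin by auto
  ultimately have "c = 1" by simp
  then show ?thesis using orbit g by simp
qed

end

section \<open>The Singer group\<close>

context field
begin

lemma mult_comm_group: "comm_group (mult_of R)"
  by (rule group.group_comm_groupI[OF field_mult_group]) (simp add: m_comm)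

lemma singer_group_comm_group:
  assumes "subfield K R"
  shows "comm_group (singer_group R K)"
  unfolding singer_group_def
  by (rule comm_group.abelian_FactGroup[OF mult_comm_group subgroup_mult_of[OF assms]])

lemma subfield_normal:
  assumes "subfield K R"
  shows "K - {\<zero>} \<lhd> mult_of R"
  using comm_group.subgroup_imp_normal[OF mult_comm_group subgroup_mult_of[OF assms]] .

lemma carrier_singer_group:
  "carrier (singer_group R K) = proj_point R K ` (carrier R - {\<zero>})"
  by (simp add: singer_group_def carrier_FactGroup proj_point_def)

lemma proj_point_pow:
  assumes "subfield K R" and "x \<in> carrier R - {\<zero>}"
  shows "proj_point R K x [^]\<^bsub>singer_group R K\<^esub> (n::nat) = proj_point R K (x [^] n)"
  using normal.FactGroup_pow[OF subfield_normal[OF assms(1)], of x n] assms(2)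
  by (simp add: singer_group_def proj_point_def nat_pow_mult_of)

text \<open>Lagrange for the q - 1 nonzero scalars among the q^v - 1 nonzero field elements,
  followed by cancelling q - 1.\<close>

lemma order_singer_group:
  assumes K: "subfield K R" and "card K = q" and ord: "order R = q ^ v" and q: "q \<ge> 2"
  shows "order (singer_group R K) = (\<Sum>i<v. q ^ i)"
proof -
  have "order R > 0"
    using ord q by simp
  then have fin: "finite (carrier R)"
    by (simp add: order_gt_0_iff_finite)
  then have fK: "finite K"
    using subfieldE(3)[OF K] finite_subset by blast
  have "\<zero> \<in> K"
    using K by (simp add: subfieldE(1) subringE(2))
  then have "card (K - {\<zero>}) = q - 1"
    using assms(2) fK by simp
  then have "order (singer_group R K) * (q - 1) = q ^ v - 1"
    using group.lagrange[OF field_mult_group subgroup_mult_of[OF K]] order_mult_of[OF fin] ord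
    by (simp add: singer_group_def order_def FactGroup_def)
  also have "\<dots> = (\<Sum>i<v. q ^ i) * (q - 1)"
    by (simp only: power_diff_1_eq_nat mult.commute)
  finally show ?thesis using q by simp
qed

section \<open>Projective subspaces as sets of points, and their Frobenius images\<close>

lemma proj_subspace_subset:
  assumes "subfield K R" and "proj_subspace R K d B"
  shows "B \<subseteq> carrier (singer_group R K)"
  using assms space_subgroup_props(1)[OF assms(1)]
  unfolding proj_subspace_def carrier_singer_group by blast

text \<open>The points of \<open>B\<close> are cosets of size q - 1 that partition the q^(d+1) - 1
  nonzero vectors of the underlying space.\<close>

lemma card_proj_subspace:
  assumes K: "subfield K R" and "card K = q" and q: "q \<ge> 2"
    and B: "proj_subspace R K d B"
  shows "finite B" and "card B = (\<Sum>i<d + 1. q ^ i)"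
proof -
  interpret M: group "mult_of R" by (rule field_mult_group)
  have fK: "finite K"
    using assms(2) q by (intro card_ge_0_finite) simp
  have K0: "\<zero> \<in> K"
    using K by (simp add: subfieldE(1) subringE(2))
  have sub: "subgroup (K - {\<zero>}) (mult_of R)"
    by (rule subgroup_mult_of[OF K])
  obtain W where W: "dimension (d + 1) K W" and B_eq: "B = proj_point R K ` (W - {\<zero>})"
    using B unfolding proj_subspace_def by blast
  note props = space_subgroup_props[OF K W]
  have card_W: "card W = q ^ (d + 1)"
    using card_dimension[OF K W fK] assms(2) by simp
  then have fW: "finite W"
    using q by (intro card_ge_0_finite) simp
  show fB: "finite B"
    using fW B_eq by simp
  have B_cosets: "B \<subseteq> rcosets\<^bsub>mult_of R\<^esub> (K - {\<zero>})"
    unfolding B_eq proj_point_def using props(1) by (auto simp: RCOSETS_def)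
  have Union_B: "\<Union>B = W - {\<zero>}"
  proof
    show "\<Union>B \<subseteq> W - {\<zero>}"
      using props(1,5) subfieldE(3)[OF K]
      unfolding B_eq proj_point_def r_coset_def by (auto simp: subset_iff dest!: integral)
    show "W - {\<zero>} \<subseteq> \<Union>B"
    proof
      fix w assume w: "w \<in> W - {\<zero>}"
      then have "w \<in> proj_point R K w"
        unfolding proj_point_def using props(1) by (intro M.rcos_self[OF _ sub]) auto
      then show "w \<in> \<Union>B"
        using w B_eq by blast
    qed
  qed
  have "(q - 1) * card B = card (\<Union>B)"
  proof (rule card_partition[OF fB])
    show "finite (\<Union>B)" using Union_B fW by simp
    show "card c = q - 1" if "c \<in> B" for c
      using M.card_rcosets_equal[of c "K - {\<zero>}"] that B_cosets K0 fK assms(2) subgroup.subset[OF sub]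
      by auto
    show "c \<inter> c' = {}" if "c \<in> B" "c' \<in> B" "c \<noteq> c'" for c c'
      using M.rcos_disjoint[OF sub] that B_cosets by (auto simp: pairwise_def disjnt_def)
  qed
  also have "\<dots> = q ^ (d + 1) - 1"
    using Union_B fW props(2) card_W by simp
  also have "\<dots> = (q - 1) * (\<Sum>i<d + 1. q ^ i)"
    by (rule power_diff_1_eq_nat)
  finally show "card B = (\<Sum>i<d + 1. q ^ i)"
    using q by simp
qed

text \<open>Fermat's little theorem: Lagrange in the multiplicative group of \<open>K\<close>
  settles nonzero \<open>a\<close>.\<close>

lemma subfield_pow_card:
  assumes K: "subfield K R" and fin: "finite K" and a: "a \<in> K"
  shows "a [^] card K = a"
proof (cases "a = \<zero>")
  case True
  have "card K > 0" using fin a by (auto simp: card_gt_0_iff)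
  with True show ?thesis by (simp add: nat_pow_zero)
next
  case False
  have sub: "subgroup (K - {\<zero>}) (mult_of R)"
    by (rule subgroup_mult_of[OF K])
  interpret H: group "mult_of R \<lparr>carrier := K - {\<zero>}\<rparr>"
    by (rule subgroup.subgroup_is_group[OF sub field_mult_group])
  have K0: "\<zero> \<in> K"
    using K by (simp add: subfieldE(1) subringE(2))
  have "a [^]\<^bsub>mult_of R \<lparr>carrier := K - {\<zero>}\<rparr>\<^esub> (card K - 1) = \<one>"
    using H.pow_order_eq_1[of a] a False K0 fin by (simp add: order_def)
  then have "a [^] (card K - 1) = \<one>"
    by (simp add: nat_pow_def mult_of_def)
  moreover have "a \<in> carrier R"
    using a subfieldE(3)[OF K] by blast
  moreover have "card K = Suc (card K - 1)"
    using a fin card_gt_0_iff[of K] by auto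
  ultimately show ?thesis
    by (metis nat_pow_Suc l_one)
qed

text \<open>\<alpha> is induced by \<open>x [^] (q ^ i)\<close> on the field. That map is additive
  because q is a power of the characteristic, fixes \<open>K\<close> pointwise and has trivial
  kernel, so it preserves dimensions of \<open>K\<close>-subspaces.\<close>

lemma proj_subspace_frob_image:
  assumes K: "subfield K R" and q: "card K = q" "primepow q" and ord: "order R = q ^ v"
    and B: "proj_subspace R K d B" and v: "v > 0" and \<alpha>: "\<alpha> \<in> frob (singer_group R K) q v"
  shows "proj_subspace R K d (\<alpha> ` B)"
proof -
  interpret S: comm_group "singer_group R K"
    by (rule singer_group_comm_group[OF K])
  obtain i where \<alpha>_eq: "\<alpha> = restrict (\<lambda>x. x [^]\<^bsub>singer_group R K\<^esub> (q ^ i)) (carrier (singer_group R K))"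
    using \<alpha> unfolding S.frob_eq[OF v] by blast
  obtain p m where p: "prime p" and m: "q = p ^ m" "m > 0"
    using q(2) unfolding primepow_def by blast
  have q2: "q \<ge> 2"
    using primepow_gt_Suc_0[OF q(2)] by simp
  have fK: "finite K"
    using q(1) q2 by (intro card_ge_0_finite) simp
  have "order R > 0"
    using ord q2 by simp
  then have "finite (carrier R)"
    by (simp add: order_gt_0_iff_finite)
  then have char: "[p] \<cdot>\<^bsub>R\<^esub> \<one> = \<zero>"
    using ord m by (intro char_of_prime_power_order[of p "m * v"]) (auto simp: power_mult)
  obtain W where W: "dimension (d + 1) K W" and B_eq: "B = proj_point R K ` (W - {\<zero>})"
    using B unfolding proj_subspace_def by blast
  have W_carrier: "W \<subseteq> carrier R"
    by (rule space_subgroup_props(1)[OF K W])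
  let ?f = "\<lambda>x. x [^] (q ^ i)"
  have add: "?f (x \<oplus> y) = ?f x \<oplus> ?f y" if "x \<in> carrier R" "y \<in> carrier R" for x y
    using add_pow_prime_power_char[OF p char that, of "m * i"] by (simp add: m power_mult)
  have fix_K: "?f a = a" if "a \<in> K" for a
  proof (induction i)
    case (Suc i)
    have "a \<in> carrier R" using that subfieldE(3)[OF K] by blast
    then have "a [^] (q ^ Suc i) = (a [^] (q ^ i)) [^] q"
      by (simp add: nat_pow_pow mult.commute)
    then show ?case
      using Suc subfield_pow_card[OF K fK that] q by simp
  qed (use that subfieldE(3)[OF K] in auto)
  have zero: "?f \<zero> = \<zero>"
    using q2 by (simp add: nat_pow_zero)
  \<comment> \<open>Powers of a nonzero element stay in the multiplicative group.\<close>
  have nz: "?f x = \<zero> \<longleftrightarrow> x = \<zero>" if "x \<in> carrier R" for x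
    using that zero monoid.nat_pow_closed[OF group.is_monoid[OF field_mult_group], of x "q ^ i"]
    by (auto simp: nat_pow_mult_of)
  have inj: "inj_on ?f (carrier R)"
  proof (rule inj_onI)
    fix x y assume xy: "x \<in> carrier R" "y \<in> carrier R" "?f x = ?f y"
    \<comment> \<open>Additivity reduces injectivity to the trivial kernel.\<close>
    have "?f x = ?f (x \<ominus> y) \<oplus> ?f y"
      using xy add[of "x \<ominus> y" y] by (simp add: minus_eq a_assoc l_neg)
    with xy have "?f (x \<ominus> y) = \<zero>"
      by (metis minus_closed nat_pow_closed add.r_cancel_one')
    then show "x = y"
      using nz[of "x \<ominus> y"] xy by simp
  qed
  have "dimension (d + 1) K (?f ` W)"
  proof (rule dimension_linear_image[OF W K _ inj add])
    show "?f (a \<otimes> x) = a \<otimes> ?f x" if "a \<in> K" "x \<in> carrier R" for a x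
      using that fix_K[OF that(1)] subfieldE(3)[OF K] nat_pow_distrib[of a x] by auto
  qed (use zero in auto)
  moreover have "\<alpha> ` B = proj_point R K ` (?f ` W - {\<zero>})"
  proof -
    have "\<alpha> ` B = (\<lambda>x. x [^]\<^bsub>singer_group R K\<^esub> (q ^ i)) ` B"
      unfolding \<alpha>_eq using proj_subspace_subset[OF K B] by (intro image_cong) auto
    also have "\<dots> = (\<lambda>w. proj_point R K (?f w)) ` (W - {\<zero>})"
      unfolding B_eq image_image using W_carrier by (intro image_cong refl proj_point_pow[OF K]) auto
    also have "\<dots> = proj_point R K ` ?f ` (W - {\<zero>})"
      by (simp add: image_image)
    also have "?f ` (W - {\<zero>}) = ?f ` W - {\<zero>}"
      using W_carrier nz by auto
    finally show ?thesis .
  qed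
  ultimately show ?thesis
    unfolding proj_subspace_def by blast
qed

end

section \<open>From the real brackets to natural sums, and the final count\<close>

lemma q_bracket_eq_sum:
  assumes "q \<ge> 2"
  shows "q_bracket q n = real (\<Sum>i<n. q ^ i)"
  using assms by (simp add: q_bracket_def geometric_sum)

theorem theorem6p5:
  fixes F :: "('a, 'b) ring_scheme" and K :: "'a set"
    and q k v u :: nat and \<I> :: "'a set set set"
  assumes "primepow q"
    and "k \<ge> 2"
    and "prime v"
    and "[v = 1] (mod k * (k - 1))"
    and "field F" and "order F = q ^ v"
    and "subfield K F" and "card K = q"
    and "q_bracket q (v - 1) / (q_bracket q k * q_bracket q (k - 1)) = real u * real v"
    and "\<not> [q = 1] (mod v)"
    and "\<forall>B\<in>\<I>. proj_subspace F K (k - 1) B"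
    and "card \<I> = u"
    and "evenly_distributed (family_differences (singer_group F K) \<I> (\<lambda>B. B))
           (frob_orbits (singer_group F K) q v)"
  shows "q_difference_family F K k (\<I> \<times> frob (singer_group F K) q v) (\<lambda>(B, \<alpha>). \<alpha> ` B)"
proof -
  interpret F: field F by fact
  let ?G = "singer_group F K"
  interpret G: comm_group ?G
    by (rule F.singer_group_comm_group[OF assms(7)])
  let ?s = "\<lambda>n. \<Sum>i<n. q ^ i"
  let ?M = "family_differences ?G \<I> (\<lambda>B. B)"
  have q2: "q \<ge> 2"
    using primepow_gt_Suc_0[OF assms(1)] by simp
  have v2: "v \<ge> 2"
    using assms(3) by (rule prime_ge_2_nat)
  have s_pos: "?s n > 0" if "n > 0" for n
    using that by (intro sum_pos2[where i = 0]) auto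
  have s_Suc: "?s (Suc n) = 1 + q * ?s n" for n
    by (simp only: sum.lessThan_Suc_shift) (simp add: sum_distrib_left)
  have ord: "order ?G = ?s v"
    by (rule F.order_singer_group[OF assms(7,8,6) q2])
  have s_eq: "?s (v - 1) = u * v * (?s k * ?s (k - 1))"
  proof -
    \<comment> \<open>Since \<open>k \<ge> 2\<close>, both sums are nonempty; the denominator can be
      cleared and the equation read in the naturals.\<close>
    have "real (?s k) * real (?s (k - 1)) \<noteq> 0"
      using s_pos[of k] s_pos[of "k - 1"] assms(2)
      by (simp only: mult_eq_0_iff of_nat_eq_0_iff) linarith
    then have "real (?s (v - 1)) = real u * real v * (real (?s k) * real (?s (k - 1)))"
      using assms(9) unfolding q_bracket_eq_sum[OF q2] by (simp only: divide_eq_eq simp_thms if_True)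
    then show ?thesis
      by (simp only: of_nat_mult[symmetric] of_nat_eq_iff)
  qed
  \<comment> \<open>The left side of \<open>s_eq\<close> is positive. Finiteness of \<I> follows, an
    infinite set having cardinality 0.\<close>
  then have "u > 0"
    using s_pos[of "v - 1"] v2 by (cases u) auto
  then have fin: "finite \<I>"
    using assms(12) by (intro card_ge_0_finite) simp
  have I: "B \<subseteq> carrier ?G" if "B \<in> \<I>" for B
    using F.proj_subspace_subset[OF assms(7)] assms(11) that by blast
  have M: "set_mset ?M \<subseteq> carrier ?G - {\<one>\<^bsub>?G\<^esub>}"
    using G.differences_subset[OF I] fin by (fastforce simp: family_differences_def set_mset_sum)
  have "size ?M = (\<Sum>B\<in>\<I>. ?s k * (?s k - 1))"
    unfolding family_differences_def size_multiset_sum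
  proof (rule sum.cong[OF refl])
    fix B assume "B \<in> \<I>"
    with assms(11) have B: "proj_subspace F K (k - 1) B" by blast
    then show "size (differences ?G B) = ?s k * (?s k - 1)"
      using F.card_proj_subspace[OF assms(7,8) q2 B] size_differences[of B ?G] assms(2) by simp
  qed
  then have "v * size ?M = v * u * (?s k * (?s k - 1))"
    using assms(12) by simp
  \<comment> \<open>Writing [n] for the sum up to n, [k] - 1 = q [k-1] brings in the denominator of
    the hypothesis, and [v] - 1 = q [v-1] then yields the number of non-identity points.\<close>
  also have "?s k - 1 = q * ?s (k - 1)"
    using s_Suc[of "k - 1"] assms(2) by simp
  also have "v * u * (?s k * (q * ?s (k - 1))) = q * ?s (v - 1)"
    unfolding s_eq by (simp only: mult_ac)
  also have "\<dots> = order ?G - 1"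
    using s_Suc[of "v - 1"] v2 ord by simp
  finally have size_M: "v * size ?M = order ?G - 1" .
  show ?thesis
    unfolding q_difference_family_def
  proof (intro conjI ballI)
    show "finite (\<I> \<times> frob ?G q v)"
      using fin v2 by (simp add: G.frob_eq)
  next
    fix j assume "j \<in> \<I> \<times> frob ?G q v"
    then show "proj_subspace F K (k - 1) (case j of (B, \<alpha>) \<Rightarrow> \<alpha> ` B)"
      using F.proj_subspace_frob_image[OF assms(7,8,1,6)] assms(11) v2 by auto
  next
    fix g assume "g \<in> carrier ?G - {\<one>\<^bsub>?G\<^esub>}"
    then have g: "g \<in> carrier ?G" "g \<noteq> \<one>\<^bsub>?G\<^esub>" by auto
    show "count (family_differences ?G (\<I> \<times> frob ?G q v) (\<lambda>(B, \<alpha>). \<alpha> ` B)) g = 1"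
      using G.count_family_differences_frob[OF ord assms(3,10) fin I g]
        G.frobenius_orbit_meets_once[OF ord assms(3,10) M size_M assms(13) g] by simp
  qed
qed

end
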